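(* Let $M$ be a matroid of rank $n$, where $n \ge 2$, and let $B_1, \dots, B_n$ be pairwise disjoint bases of $M$. Then there are at least $\left\lfloor \frac{n}{6 \lceil \log n \rceil} \right\rfloor$ pairwise disjoint transversal bases of $(B_1, \dots, B_n)$.
   Context: Here $\log$ denotes the natural logarithm. A transversal basis of a collection $(B_1,\dots,B_n)$ of sets of elements in a rank-$n$ matroid is a basis of the matroid containing exactly one element from each of $B_1,\dots,B_n$. *)

theory Defs
  imports Complex_Main
begin

definition matroid :: "'a set \<Rightarrow> ('a set \<Rightarrow> bool) \<Rightarrow> bool" where
  "matroid E indep \<longleftrightarrow>
     finite E \<and>
     (\<forall>I. indep I \<longrightarrow> I \<subseteq> E) \<and>
     indep {} \<and>
     (\<forall>I J. indep J \<and> I \<subseteq> J \<longrightarrow> indep I) \<and>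
     (\<forall>I J. indep I \<and> indep J \<and> card I < card J \<longrightarrow>
        (\<exists>x \<in> J - I. indep (insert x I)))"

definition basis :: "'a set \<Rightarrow> ('a set \<Rightarrow> bool) \<Rightarrow> 'a set \<Rightarrow> bool" where
  "basis E indep B \<longleftrightarrow> indep B \<and> (\<forall>x \<in> E - B. \<not> indep (insert x B))"

definition matroid_rank :: "'a set \<Rightarrow> ('a set \<Rightarrow> bool) \<Rightarrow> nat" where
  "matroid_rank E indep = Max (card ` {I. indep I})"

definition transversal_basis ::
    "'a set \<Rightarrow> ('a set \<Rightarrow> bool) \<Rightarrow> nat \<Rightarrow> (nat \<Rightarrow> 'a set) \<Rightarrow> 'a set \<Rightarrow> bool" where
  "transversal_basis E indep n B T \<longleftrightarrow>
     basis E indep T \<and> (\<forall>i < n. card (T \<inter> B i) = 1)"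

end

theory Submission
  imports Defs "HOL-Combinatorics.Permutations"
begin

text \<open>Let \<open>K = 6 \<lceil>ln n\<rceil>\<close> and \<open>t = \<lfloor>n / K\<rfloor>\<close>. Order each \<open>B i\<close> uniformly at random and cut off \<open>t\<close>
  blocks of size \<open>K\<close>, the \<open>j\<close>-th being \<open>A i j\<close>. By Rado's theorem it suffices that for every \<open>j\<close> and
  every nonempty set \<open>J\<close> of indices the union \<open>\<Union>i\<in>J. A i j\<close> has rank at least \<open>m = |J|\<close>. Each element drawn
  from a basis raises the current rank \<open>r\<close> with probability at least \<open>(n - r) / n\<close>, so with
  \<open>c = n - m + 1\<close> the expectation of \<open>(n - r choose c)\<close> shrinks by a factor \<open>1 - c / n\<close> per draw.
  After \<open>K m\<close> draws it is at most \<open>(n choose c) (1 - c / n)^(K m)\<close>, and this bounds the probability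
  that the rank stays below \<open>m\<close>. Summed over all \<open>j\<close> and \<open>J\<close> these bounds are less than \<open>1\<close>.\<close>

section \<open>Rank function of a finite matroid\<close>

locale finite_matroid =
  fixes E :: "'a set" and indep :: "'a set \<Rightarrow> bool"
  assumes matroid: "matroid E indep"
begin

lemma finite_carrier: "finite E"
  and indep_subset_carrier: "indep I \<Longrightarrow> I \<subseteq> E"
  and indep_empty: "indep {}"
  and indep_subset: "indep J \<Longrightarrow> I \<subseteq> J \<Longrightarrow> indep I"
  and augment: "indep I \<Longrightarrow> indep J \<Longrightarrow> card I < card J \<Longrightarrow> \<exists>x \<in> J - I. indep (insert x I)"
  using matroid unfolding matroid_def by blast+

lemma finite_indep: "indep I \<Longrightarrow> finite I"
  using finite_carrier indep_subset_carrier finite_subset by blast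

text \<open>\<open>X\<close> need not lie in \<open>E\<close>: elements outside the carrier belong
  to no independent set and contribute nothing.\<close>

definition rk :: "'a set \<Rightarrow> nat" where
  "rk X = Max (card ` {I. indep I \<and> I \<subseteq> X})"

lemma finite_indeps: "finite {I. indep I \<and> P I}"
  by (rule finite_subset[of _ "Pow E"]) (auto dest: indep_subset_carrier simp: finite_carrier)

lemma card_le_rk: "indep I \<Longrightarrow> I \<subseteq> X \<Longrightarrow> card I \<le> rk X"
  unfolding rk_def by (rule Max_ge) (auto simp: finite_indeps)

lemma rk_attained: "\<exists>I. indep I \<and> I \<subseteq> X \<and> card I = rk X"
proof -
  have "rk X \<in> card ` {I. indep I \<and> I \<subseteq> X}"
    unfolding rk_def by (rule Max_in) (use indep_empty in \<open>auto simp: finite_indeps\<close>)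
  then show ?thesis by auto
qed

text \<open>Augmenting from an independent subset of \<open>X\<close> of size \<open>rk X\<close>
  adds one element at a time, so the induction is on the missing size.\<close>

lemma extend_to_rk:
  assumes "indep I" "I \<subseteq> X"
  shows "\<exists>J. I \<subseteq> J \<and> J \<subseteq> X \<and> indep J \<and> card J = rk X"
  using assms
proof (induction "rk X - card I" arbitrary: I rule: less_induct)
  case less
  show ?case
  proof (cases "card I = rk X")
    case True
    then show ?thesis using less.prems by blast
  next
    case False
    then have lt: "card I < rk X"
      using card_le_rk[OF less.prems] by simp
    obtain K where K: "indep K" "K \<subseteq> X" "card K = rk X"
      using rk_attained by blast
    obtain x where x: "x \<in> K - I" "indep (insert x I)"
      using augment[OF less.prems(1) K(1)] lt K(3) by auto
    have "card (insert x I) = Suc (card I)"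
      using x(1) finite_indep[OF less.prems(1)] by simp
    then have "rk X - card (insert x I) < rk X - card I"
      using lt by simp
    from less.hyps[OF this x(2)] x(1) K(2) less.prems(2) show ?thesis
      by blast
  qed
qed

lemma rk_mono: "X \<subseteq> Y \<Longrightarrow> rk X \<le> rk Y"
  using rk_attained[of X] card_le_rk[of _ Y] by (metis subset_trans)

lemma rk_indep: "indep I \<Longrightarrow> rk I = card I"
  using rk_attained[of I] card_le_rk[of I I] card_mono[OF finite_indep[of I]]
  by (metis antisym subset_refl)

text \<open>A largest independent subset \<open>I\<close> of \<open>X \<inter> Y\<close> extends to
  a largest one \<open>J\<close> of \<open>X \<union> Y\<close>. Counting \<open>J\<close> inside
  \<open>X\<close> and inside \<open>Y\<close> covers \<open>J\<close> once and its part in both,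
  which contains \<open>I\<close>, a second time.\<close>

lemma rk_submodular: "rk (X \<union> Y) + rk (X \<inter> Y) \<le> rk X + rk Y"
proof -
  obtain I where I: "indep I" "I \<subseteq> X \<inter> Y" "card I = rk (X \<inter> Y)"
    using rk_attained by blast
  obtain J where J: "I \<subseteq> J" "J \<subseteq> X \<union> Y" "indep J" "card J = rk (X \<union> Y)"
    using extend_to_rk[OF I(1), of "X \<union> Y"] I(2) by blast
  have fin: "finite J" using J(3) by (rule finite_indep)
  have "card (J \<inter> X) \<le> rk X" "card (J \<inter> Y) \<le> rk Y"
    by (auto intro!: card_le_rk intro: indep_subset[OF J(3)])
  moreover have "card (J \<inter> X) + card (J \<inter> Y) = card J + card (J \<inter> X \<inter> (J \<inter> Y))"
  proof -
    have "J \<inter> X \<union> J \<inter> Y = J" using J(2) by blast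
    then show ?thesis
      using card_Un_Int[of "J \<inter> X" "J \<inter> Y"] fin by simp
  qed
  moreover have "card I \<le> card (J \<inter> X \<inter> (J \<inter> Y))"
    by (rule card_mono) (use fin I(2) J(1) in auto)
  ultimately show ?thesis using I(3) J(4) by linarith
qed

text \<open>A largest independent subset \<open>I\<close> of \<open>X\<close> stays largest in
  \<open>X \<union> Y\<close>: any element added to it would, on its own, already raise the rank of
  \<open>X\<close>.\<close>

lemma rk_Un_eq:
  assumes "\<And>x. x \<in> Y \<Longrightarrow> rk (insert x X) = rk X"
  shows "rk (X \<union> Y) = rk X"
proof -
  obtain I where I: "indep I" "I \<subseteq> X" "card I = rk X"
    using rk_attained by blast
  obtain J where J: "I \<subseteq> J" "J \<subseteq> X \<union> Y" "indep J" "card J = rk (X \<union> Y)"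
    using extend_to_rk[OF I(1), of "X \<union> Y"] I(2) by blast
  have "J \<subseteq> I"
  proof
    fix x assume x: "x \<in> J"
    show "x \<in> I"
    proof (rule ccontr)
      assume "x \<notin> I"
      have "indep (insert x I)"
        using indep_subset[OF J(3)] J(1) x by blast
      then have "Suc (card I) \<le> rk (insert x X)"
        using card_le_rk[of "insert x I" "insert x X"] I(2) \<open>x \<notin> I\<close> finite_indep[OF I(1)]
        by auto
      moreover have "rk (insert x X) = rk X"
      proof (cases "x \<in> Y")
        case False
        then have "x \<in> X" using x J(2) by blast
        then show ?thesis by (simp add: insert_absorb)
      qed (rule assms)
      ultimately show False using I(3) by simp
    qed
  qed
  then have "J = I" using J(1) by blast
  then show ?thesis using I(3) J(4) by simp
qed

section \<open>Rado's theorem on independent transversals\<close>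

text \<open>Induction on the total size of the sets. If some \<open>A i\<close> has two elements,
  one of them can be deleted while the rank condition survives; once all sets are singletons, the
  condition for \<open>S\<close> itself gives the transversal.\<close>

lemma rado:
  assumes "finite S" "\<And>i. i \<in> S \<Longrightarrow> finite (A i)"
    and "\<And>J. J \<subseteq> S \<Longrightarrow> card J \<le> rk (\<Union>i\<in>J. A i)"
  shows "\<exists>f. (\<forall>i\<in>S. f i \<in> A i) \<and> inj_on f S \<and> indep (f ` S)"
  using assms(2,3)
proof (induction "\<Sum>i\<in>S. card (A i)" arbitrary: A rule: less_induct)
  case (less A)
  note finS = \<open>finite S\<close>
  show ?case
  proof (cases "\<exists>i\<in>S. \<exists>x\<in>A i. \<exists>y\<in>A i. x \<noteq> y")
    case False
    have "\<exists>x. A i = {x}" if "i \<in> S" for i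
    proof -
      have "card {i} \<le> rk (A i)"
        using less.prems(2)[of "{i}"] that by simp
      then have "A i \<noteq> {}"
        using rk_indep[OF indep_empty] by auto
      then show ?thesis using False that by blast
    qed
    then obtain f where f: "\<And>i. i \<in> S \<Longrightarrow> A i = {f i}" by metis
    have "(\<Union>i\<in>S. A i) = f ` S" using f by auto
    then have "card S \<le> rk (f ` S)" using less.prems(2)[of S] by simp
    moreover obtain I where I: "indep I" "I \<subseteq> f ` S" "card I = rk (f ` S)"
      using rk_attained by blast
    moreover have "card (f ` S) \<le> card S" using finS by (rule card_image_le)
    \<comment> \<open>The chain \<open>card S \<le> rk (f\<close> S) = card I \<le> card (f
      \<open>S) \<le> card S\<close> collapses to equalities.\<close>
    ultimately have "I = f ` S" and "card (f ` S) = card S"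
      using card_mono[of "f ` S" I] card_seteq[of "f ` S" I] finS by auto
    then show ?thesis using I(1) f finS by (auto intro!: exI[of _ f] eq_card_imp_inj_on)
  next
    case True
    then obtain i x y where i: "i \<in> S" and xy: "x \<in> A i" "y \<in> A i" "x \<noteq> y" by blast
    define D where "D z = A(i := A i - {z})" for z
    have D_le: "D z k \<subseteq> A k" for z k by (auto simp: D_def)
    have smaller: "(\<Sum>k\<in>S. card (D z k)) < (\<Sum>k\<in>S. card (A k))" if "z \<in> A i" for z
    proof (rule sum_strict_mono_ex1[OF finS])
      show "\<forall>k\<in>S. card (D z k) \<le> card (A k)"
        using card_mono[OF less.prems(1) D_le] by blast
      show "\<exists>k\<in>S. card (D z k) < card (A k)"
        using card_Diff1_less[OF less.prems(1)[OF i] that] i by (intro bexI[of _ i]) (simp_all only: D_def fun_upd_same)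
    qed
    \<comment> \<open>If both deletions failed, with violating index sets \<open>P\<close> and
      \<open>Q\<close>, then both would contain \<open>i\<close>, and submodularity applied to the
      two shrunken unions gives a contradiction.\<close>
    have "\<exists>z\<in>{x, y}. \<forall>J\<subseteq>S. card J \<le> rk (\<Union>k\<in>J. D z k)"
    proof (rule ccontr)
      assume "\<not> ?thesis"
      then obtain P Q where P: "P \<subseteq> S" "rk (\<Union>k\<in>P. D x k) < card P"
        and Q: "Q \<subseteq> S" "rk (\<Union>k\<in>Q. D y k) < card Q"
        by (auto simp: not_le)
      have mem: "i \<in> R" if "R \<subseteq> S" "rk (\<Union>k\<in>R. D z k) < card R" for R z
      proof (rule ccontr)
        assume "i \<notin> R"
        then have "(\<Union>k\<in>R. D z k) = (\<Union>k\<in>R. A k)"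
          by (intro SUP_cong) (auto simp: D_def)
        then show False using less.prems(2)[OF that(1)] that(2) by simp
      qed
      have iP: "i \<in> P" and iQ: "i \<in> Q" using mem P Q by blast+
      have fin: "finite P" "finite Q" using P Q finS finite_subset by blast+
      let ?X = "\<Union>k\<in>P. D x k" and ?Y = "\<Union>k\<in>Q. D y k"
      \<comment> \<open>Since \<open>x\<close> and \<open>y\<close> differ, \<open>D x i\<close> and
        \<open>D y i\<close> together recover all of \<open>A i\<close>.\<close>
      have 1: "(\<Union>k\<in>P \<union> Q. A k) \<subseteq> ?X \<union> ?Y"
      proof
        fix z assume "z \<in> (\<Union>k\<in>P \<union> Q. A k)"
        then obtain k where k: "k \<in> P \<union> Q" "z \<in> A k" by blast
        show "z \<in> ?X \<union> ?Y"
        proof (cases "k = i")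
          case True
          then have "z \<in> D x i \<or> z \<in> D y i" using k xy(3) by (auto simp: D_def)
          then show ?thesis using iP iQ by blast
        next
          case False
          then have "z \<in> D x k" "z \<in> D y k" using k by (auto simp: D_def)
          then show ?thesis using k by blast
        qed
      qed
      have 2: "(\<Union>k\<in>P \<inter> Q - {i}. A k) \<subseteq> ?X \<inter> ?Y"
      proof
        fix z assume "z \<in> (\<Union>k\<in>P \<inter> Q - {i}. A k)"
        then obtain k where k: "k \<in> P" "k \<in> Q" "k \<noteq> i" "z \<in> A k" by blast
        then have "z \<in> D x k" "z \<in> D y k" by (auto simp: D_def)
        then show "z \<in> ?X \<inter> ?Y" using k by blast
      qed
      have "card (P \<union> Q) \<le> rk (?X \<union> ?Y)"
        using less.prems(2)[of "P \<union> Q"] P(1) Q(1) rk_mono[OF 1] by simp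
      moreover have "card (P \<inter> Q - {i}) \<le> rk (?X \<inter> ?Y)"
        using less.prems(2)[of "P \<inter> Q - {i}"] P(1) rk_mono[OF 2] by (meson Diff_subset inf_le1 le_trans subset_trans)
      moreover have "card (P \<inter> Q - {i}) + 1 = card (P \<inter> Q)"
        using iP iQ fin by (metis IntI Suc_eq_plus1 card_Suc_Diff1 finite_Int)
      moreover have "card P + card Q = card (P \<union> Q) + card (P \<inter> Q)"
        by (rule card_Un_Int[OF fin])
      \<comment> \<open>The two violations bound the sum of ranks by
        \<open>card P + card Q - 2\<close>, while the union and the intersection without
        \<open>i\<close> force at least \<open>card P + card Q - 1\<close>.\<close>
      ultimately show False using rk_submodular[of ?X ?Y] P(2) Q(2) by linarith
    qed
    then obtain z where z: "z \<in> A i" "\<And>J. J \<subseteq> S \<Longrightarrow> card J \<le> rk (\<Union>k\<in>J. D z k)"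
      using xy by blast
    have "finite (D z k)" if "k \<in> S" for k
      using less.prems(1)[OF that] D_le finite_subset by blast
    from less.hyps[OF smaller[OF z(1)] this z(2)]
    obtain f where "\<forall>k\<in>S. f k \<in> D z k" "inj_on f S" "indep (f ` S)" by blast
    then show ?thesis using D_le by (auto intro!: exI[of _ f])
  qed
qed

section \<open>Expected rank deficiency under random draws\<close>

text \<open>The elements of \<open>B\<close> that leave the rank of \<open>X\<close> unchanged also
  do so jointly; being independent, there are at most \<open>rk X\<close> of them.\<close>

lemma card_rk_increasing:
  assumes "indep B"
  shows "card B \<le> rk X + card {x \<in> B. rk X < rk (insert x X)}"
proof -
  let ?Y = "{x \<in> B. rk (insert x X) = rk X}" and ?Z = "{x \<in> B. rk X < rk (insert x X)}"
  have "rk (X \<union> ?Y) = rk X" by (rule rk_Un_eq) simp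
  then have "card ?Y \<le> rk X"
    using card_le_rk[of ?Y "X \<union> ?Y"] indep_subset[OF assms, of ?Y] by auto
  moreover have "B = ?Y \<union> ?Z"
    using rk_mono[OF subset_insertI] by (auto simp: not_less intro: antisym)
  then have "card B \<le> card ?Y + card ?Z"
    by (metis card_Un_le)
  ultimately show ?thesis by linarith
qed

text \<open>With \<open>d = n - rk X\<close>, at least \<open>d\<close> elements of \<open>B\<close>
  raise the rank, and each lowers the coefficient from \<open>d choose c\<close> to at most
  \<open>(d - 1) choose c\<close>. By absorption, \<open>d\<close> times this drop is
  \<open>c * (d choose c)\<close>.\<close>

lemma sum_binomial_deficiency_insert:
  assumes "indep B" "card B = n" "0 < c"
  shows "(\<Sum>x\<in>B. real ((n - rk (insert x X)) choose c)) \<le> (real n - real c) * real ((n - rk X) choose c)"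
proof (cases "rk X < n")
  case False
  then have "n - rk (insert x X) = 0" for x
    using rk_mono[OF subset_insertI, of X x] by auto
  then show ?thesis using False assms(3) by (simp add: binomial_eq_0)
next
  case True
  define d where "d = n - rk X"
  define Z where "Z = {x \<in> B. rk X < rk (insert x X)}"
  let ?b = "real (d choose c)" and ?b' = "real ((d - 1) choose c)"
  have d: "d > 0" and dZ: "d \<le> card Z"
    using True card_rk_increasing[OF assms(1), of X] assms(2) by (auto simp: d_def Z_def)
  have finB: "finite B" using assms(1) by (rule finite_indep)
  have ZB: "Z \<subseteq> B" by (auto simp: Z_def)
  have "real d * ?b' = (real d - real c) * ?b"
  proof (cases "c \<le> d")
    case True
    then show ?thesis
      using binomial_absorb_comp[of d c] by (metis of_nat_diff of_nat_mult)
  next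
    case False
    then have "d choose c = 0" "(d - 1) choose c = 0" by (auto intro: binomial_eq_0)
    then show ?thesis by (simp only: of_nat_0 mult_zero_right)
  qed
  then have abs: "real d * (?b - ?b') = real c * ?b"
    by (simp add: algebra_simps)
  have mono: "?b' \<le> ?b" by (simp add: binomial_right_mono)
  have "(\<Sum>x\<in>B. real ((n - rk (insert x X)) choose c)) \<le> (\<Sum>x\<in>B. if x \<in> Z then ?b' else ?b)"
  proof (rule sum_mono)
    fix x assume "x \<in> B"
    have "n - rk (insert x X) \<le> (if x \<in> Z then d - 1 else d)"
      using rk_mono[OF subset_insertI, of X x] \<open>x \<in> B\<close> by (auto simp: d_def Z_def)
    then show "real ((n - rk (insert x X)) choose c) \<le> (if x \<in> Z then ?b' else ?b)"
      by (auto intro: binomial_right_mono split: if_splits)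
  qed
  also have "\<dots> = real (card Z) * ?b' + real (card (B - Z)) * ?b"
    using sum.subset_diff[OF ZB finB, of "\<lambda>x. if x \<in> Z then ?b' else ?b"] by simp
  also have "\<dots> = real n * ?b - real (card Z) * (?b - ?b')"
    using card_Diff_subset[OF finite_subset[OF ZB finB] ZB] card_mono[OF finB ZB] assms(2)
    by (simp add: algebra_simps of_nat_diff)
  also have "\<dots> \<le> real n * ?b - real d * (?b - ?b')"
    using mult_right_mono[of "real d" "real (card Z)" "?b - ?b'"] dZ mono by simp
  finally show ?thesis unfolding abs by (simp add: d_def[symmetric] algebra_simps)
qed

text \<open>By symmetry of the uniform distribution on permutations, the value at the new position
  \<open>a\<close> may be replaced by the value at a uniformly random position outside \<open>T\<close>.\<close>
lemma sum_permutations_insert: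
  fixes X :: "'a set"
  assumes B: "indep B" "bij_betw e {..<n} B" and c: "0 < c" "c \<le> n"
    and T: "T \<subseteq> {..<n}" and a: "a < n" "a \<notin> T"
  defines "F \<equiv> \<lambda>T p. real ((n - rk (X \<union> (e \<circ> p) ` T)) choose c)"
  shows "(\<Sum>p | p permutes {..<n}. F (insert a T) p)
         \<le> (1 - real c / real n) * (\<Sum>p | p permutes {..<n}. F T p)"
proof -
  let ?P = "{p. p permutes {..<n}}"
  have finT: "finite T" using T finite_subset by blast
  have cardB: "card B = n" using bij_betw_same_card[OF B(2)] by simp
  have "card T < n"
    using psubset_card_mono[of "{..<n}" T] T a by auto
  then have pos: "real n - real (card T) > 0" by simp
  have step: "(\<Sum>b\<in>{..<n} - T. F (insert b T) p)
      \<le> (real n - real (card T)) * (1 - real c / real n) * F T p" if p: "p permutes {..<n}" for p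
  proof -
    let ?Y = "X \<union> (e \<circ> p) ` T"
    have bij: "bij_betw (e \<circ> p) {..<n} B"
      using bij_betw_trans[OF permutes_imp_bij[OF p] B(2)] .
    have "(\<Sum>b\<in>{..<n}. F (insert b T) p) = (\<Sum>b<n. real ((n - rk (insert ((e \<circ> p) b) ?Y)) choose c))"
      by (simp add: F_def)
    also have "\<dots> = (\<Sum>x\<in>B. real ((n - rk (insert x ?Y)) choose c))"
      by (rule sum.reindex_bij_betw[OF bij])
    also have "\<dots> \<le> (real n - real c) * F T p"
      using sum_binomial_deficiency_insert[OF B(1) cardB c(1), of ?Y] by (simp add: F_def)
    finally have "(\<Sum>b\<in>{..<n}. F (insert b T) p) \<le> (real n - real c) * F T p" .
    moreover have "(\<Sum>b\<in>{..<n}. F (insert b T) p)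
        = (\<Sum>b\<in>{..<n} - T. F (insert b T) p) + (\<Sum>b\<in>T. F (insert b T) p)"
      using T by (intro sum.subset_diff) auto
    \<comment> \<open>Drawing a position of \<open>T\<close> again changes nothing; removing these
      terms leaves only fresh positions.\<close>
    moreover have "(\<Sum>b\<in>T. F (insert b T) p) = real (card T) * F T p"
      by (simp add: insert_absorb)
    ultimately have "(\<Sum>b\<in>{..<n} - T. F (insert b T) p) \<le> (real n - real c - real (card T)) * F T p"
      by (simp add: algebra_simps)
    also have "\<dots> \<le> (real n - real (card T)) * (1 - real c / real n) * F T p"
    proof (rule mult_right_mono)
      \<comment> \<open>This is exactly the gap between the two factors: drawing without replacement
        does at least as well as drawing with replacement.\<close>
      have "real c * real (card T) / real n \<ge> 0" by simp
      then show "real n - real c - real (card T) \<le> (real n - real (card T)) * (1 - real c / real n)"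
        using a by (simp add: field_simps)
    qed (simp add: F_def)
    finally show ?thesis .
  qed
  have swap: "(\<Sum>p\<in>?P. F (insert b T) p) = (\<Sum>p\<in>?P. F (insert a T) p)" if b: "b \<in> {..<n} - T" for b
  proof -
    have q: "transpose a b permutes {..<n}"
      using a b by (intro permutes_swap_id) auto
    have "(\<Sum>p\<in>?P. F (insert a T) p) = (\<Sum>p\<in>?P. F (insert a T) (p \<circ> transpose a b))"
      by (rule sum_permutations_compose_right[OF q])
    also have "\<dots> = (\<Sum>p\<in>?P. F (insert b T) p)"
    proof (rule sum.cong[OF refl])
      fix p
      \<comment> \<open>Both \<open>a\<close> and \<open>b\<close> lie outside \<open>T\<close>, so
        the transposition fixes \<open>T\<close> pointwise and only trades \<open>a\<close> for
        \<open>b\<close>.\<close>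
      have "transpose a b ` T = T"
        using a b by (intro image_cong[OF refl, of T _ id, simplified]) (auto simp: transpose_def)
      then have "(e \<circ> (p \<circ> transpose a b)) ` insert a T = (e \<circ> p) ` insert b T"
        by (simp only: image_comp[symmetric] image_insert transpose_apply_first comp_apply)
      then show "F (insert a T) (p \<circ> transpose a b) = F (insert b T) p"
        by (simp only: F_def)
    qed
    finally show ?thesis by simp
  qed
  have "(real n - real (card T)) * (\<Sum>p\<in>?P. F (insert a T) p)
      = (\<Sum>b\<in>{..<n} - T. \<Sum>p\<in>?P. F (insert b T) p)"
    using swap card_Diff_subset[OF finT T] \<open>card T < n\<close> by (simp add: of_nat_diff)
  also have "\<dots> = (\<Sum>p\<in>?P. \<Sum>b\<in>{..<n} - T. F (insert b T) p)"
    by (rule sum.swap)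
  also have "\<dots> \<le> (\<Sum>p\<in>?P. (real n - real (card T)) * (1 - real c / real n) * F T p)"
    by (rule sum_mono) (use step in simp)
  also have "\<dots> = (real n - real (card T)) * ((1 - real c / real n) * (\<Sum>p\<in>?P. F T p))"
    by (simp add: sum_distrib_left mult.assoc)
  finally show ?thesis using pos by simp
qed

text \<open>Adding the positions of \<open>T\<close> one by one costs a factor
  \<open>1 - c / n\<close> each; \<open>fact n\<close> counts the permutations.\<close>

lemma sum_permutations_le:
  assumes B: "indep B" "bij_betw e {..<n} B" and c: "0 < c" "c \<le> n"
    and T: "T \<subseteq> {..<n}"
  shows "(\<Sum>p | p permutes {..<n}. real ((n - rk (X \<union> (e \<circ> p) ` T)) choose c))
         \<le> fact n * ((1 - real c / real n) ^ card T * real ((n - rk X) choose c))"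
proof -
  have "finite T" using T finite_subset by blast
  then show ?thesis using T
  proof (induction T rule: finite_induct)
    case empty
    then show ?case by (simp add: card_permutations[OF refl])
  next
    case (insert a T)
    have "0 \<le> 1 - real c / real n" using c by (simp add: divide_simps)
    from mult_left_mono[OF insert.IH this] insert.prems
      sum_permutations_insert[OF B c, of T a X] insert.hyps
    show ?case by (simp add: mult_ac)
  qed
qed

section \<open>Choosing the permutations\<close>

text \<open>First-moment argument: were every permutation worse than the bound, so would be their
  average. The weights let a single permutation serve many estimators at once.\<close>

lemma exists_permutation:
  assumes B: "indep B" "bij_betw e {..<n} B" and fin: "finite A"
    and w: "\<And>a. a \<in> A \<Longrightarrow> 0 \<le> w a"
    and c: "\<And>a. a \<in> A \<Longrightarrow> 0 < c a \<and> c a \<le> n"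
    and T: "\<And>a. a \<in> A \<Longrightarrow> T a \<subseteq> {..<n}"
  shows "\<exists>p. p permutes {..<n} \<and>
    (\<Sum>a\<in>A. w a * real ((n - rk (X a \<union> (e \<circ> p) ` T a)) choose c a))
    \<le> (\<Sum>a\<in>A. w a * ((1 - real (c a) / real n) ^ card (T a) * real ((n - rk (X a)) choose c a)))"
    (is "\<exists>p. _ \<and> ?L p \<le> ?R")
proof (rule ccontr)
  let ?P = "{p. p permutes {..<n}}"
  assume "\<not> ?thesis"
  then have "(\<Sum>p\<in>?P. ?R) < (\<Sum>p\<in>?P. ?L p)"
  proof (intro sum_strict_mono[of ?P "\<lambda>_. ?R" ?L] finite_permutations)
    show "?P \<noteq> {}" using permutes_id by blast
  qed (auto simp: not_le)
  also have "\<dots> = (\<Sum>a\<in>A. w a * (\<Sum>p\<in>?P. real ((n - rk (X a \<union> (e \<circ> p) ` T a)) choose c a)))"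
    by (subst sum.swap) (simp add: sum_distrib_left)
  also have "\<dots> \<le> (\<Sum>a\<in>A. w a * (fact n *
      ((1 - real (c a) / real n) ^ card (T a) * real ((n - rk (X a)) choose c a))))"
    using B c T w by (intro sum_mono mult_left_mono sum_permutations_le) auto
  also have "\<dots> = (\<Sum>p\<in>?P. ?R)"
    by (simp add: card_permutations[OF refl] sum_distrib_left mult_ac)
  finally show False by simp
qed

text \<open>Derandomisation: a weighted sum of binomial coefficients of rank deficiencies serves as a
  pessimistic estimator, and the permutations are fixed one basis at a time without increasing it.\<close>
lemma exists_permutations:
  assumes B: "\<And>i. i < n \<Longrightarrow> indep (B i)" "\<And>i. i < n \<Longrightarrow> bij_betw (e i) {..<n} (B i)"
    and fin: "finite A"
    and c: "\<And>a. a \<in> A \<Longrightarrow> 0 < c a \<and> c a \<le> n"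
    and T: "\<And>a. a \<in> A \<Longrightarrow> T a \<subseteq> {..<n}"
    and m: "m \<le> n"
  shows "\<exists>s. (\<forall>i<m. s i permutes {..<n}) \<and>
    (\<Sum>a\<in>A. (1 - real (c a) / real n) ^ (card (T a) * card (J a \<inter> {m..<n})) *
       real ((n - rk (\<Union>i\<in>J a \<inter> {..<m}. (e i \<circ> s i) ` T a)) choose c a))
    \<le> (\<Sum>a\<in>A. (1 - real (c a) / real n) ^ (card (T a) * card (J a \<inter> {..<n})) * real (n choose c a))"
  using m
proof (induction m)
  case 0
  have "rk {} = 0" using rk_indep[OF indep_empty] by simp
  then show ?case by (simp add: atLeast0LessThan)
next
  case (Suc m)
  let ?q = "\<lambda>a. 1 - real (c a) / real n"
  let ?R = "\<Sum>a\<in>A. ?q a ^ (card (T a) * card (J a \<inter> {..<n})) * real (n choose c a)"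
  let ?U = "\<lambda>s a m. \<Union>i\<in>J a \<inter> {..<m}. (e i \<circ> s i) ` T a"
  \<comment> \<open>The weight collects the factors expected from the bases after \<open>m\<close>,
    whose order is still open.\<close>
  let ?w = "\<lambda>a. ?q a ^ (card (T a) * card (J a \<inter> {Suc m..<n}))"
  \<comment> \<open>When \<open>m\<close> is not in \<open>J a\<close>, basis \<open>m\<close>
    contributes no draw to this union, hence the empty block and a factor \<open>1\<close>.\<close>
  let ?T = "\<lambda>a. if m \<in> J a then T a else {}"
  have m: "m < n" using Suc.prems by simp
  from Suc obtain s where s: "\<forall>i<m. s i permutes {..<n}"
    and s_le: "(\<Sum>a\<in>A. ?q a ^ (card (T a) * card (J a \<inter> {m..<n})) * real ((n - rk (?U s a m)) choose c a)) \<le> ?R"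
    by auto
  have "\<exists>p. p permutes {..<n} \<and>
    (\<Sum>a\<in>A. ?w a * real ((n - rk (?U s a m \<union> (e m \<circ> p) ` ?T a)) choose c a))
    \<le> (\<Sum>a\<in>A. ?w a * (?q a ^ card (?T a) * real ((n - rk (?U s a m)) choose c a)))"
    using m B T c by (intro exists_permutation fin) (auto simp: divide_simps)
  then obtain p where p: "p permutes {..<n}"
    and p_le: "(\<Sum>a\<in>A. ?w a * real ((n - rk (?U s a m \<union> (e m \<circ> p) ` ?T a)) choose c a))
      \<le> (\<Sum>a\<in>A. ?w a * (?q a ^ card (?T a) * real ((n - rk (?U s a m)) choose c a)))" by blast
  let ?s = "s(m := p)"
  have U: "?U ?s a (Suc m) = ?U s a m \<union> (e m \<circ> p) ` ?T a" for a
    by (auto simp: less_Suc_eq split: if_splits)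
  have "?w a * ?q a ^ card (?T a) = ?q a ^ (card (T a) * card (J a \<inter> {m..<n}))" for a
  proof (cases "m \<in> J a")
    case True
    then have "J a \<inter> {m..<n} = insert m (J a \<inter> {Suc m..<n})" using m by auto
    then have "card (J a \<inter> {m..<n}) = Suc (card (J a \<inter> {Suc m..<n}))" by simp
    then show ?thesis using True by (simp add: power_add mult.commute)
  next
    case False
    have "J a \<inter> {m..<n} = J a \<inter> {Suc m..<n}"
      using False by (auto simp: Suc_le_eq le_less)
    then show ?thesis using False by simp
  qed
  then have "(\<Sum>a\<in>A. ?w a * (?q a ^ card (?T a) * real ((n - rk (?U s a m)) choose c a))) \<le> ?R"
    using s_le by (simp add: mult.assoc[symmetric])
  with p_le have "(\<Sum>a\<in>A. ?w a * real ((n - rk (?U ?s a (Suc m))) choose c a)) \<le> ?R"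
    unfolding U by linarith
  moreover have "\<forall>i<Suc m. ?s i permutes {..<n}" using s p by (auto simp: less_Suc_eq)
  ultimately show ?case by blast
qed

end

section \<open>Numerical estimates for the union bound\<close>

text \<open>With \<open>c = Suc n - m\<close>, symmetry turns \<open>n choose c\<close> into
  \<open>n choose (m - 1)\<close> and \<open>n choose m\<close> into
  \<open>n choose (c - 1)\<close>. Rewriting the coefficient with the larger lower index makes both
  exponents small and saves one power of \<open>n\<close>.\<close>

lemma binomial_product_le:
  assumes "1 \<le> m" "m \<le> n"
  shows "(n choose m) * (n choose (Suc n - m)) \<le> n ^ (2 * min m (Suc n - m) - 1)"
proof -
  define c where "c = Suc n - m"
  have c: "1 \<le> c" "c \<le> n" "n - c = m - 1" "n - m = c - 1" using assms by (auto simp: c_def)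
  show ?thesis
  proof (cases "m \<le> c")
    case True
    have "n choose c \<le> n ^ (m - 1)"
      using binomial_symmetric[of c n] binomial_le_pow[of "m - 1" n] c assms by simp
    then have "(n choose m) * (n choose c) \<le> n ^ m * n ^ (m - 1)"
      using binomial_le_pow[of m n] assms by (intro mult_le_mono) auto
    moreover have "m + (m - 1) = 2 * m - 1" using assms by simp
    ultimately show ?thesis using True by (simp add: c_def[symmetric] power_add[symmetric] min_def)
  next
    case False
    have "n choose m \<le> n ^ (c - 1)"
      using binomial_symmetric[of m n] binomial_le_pow[of "c - 1" n] c assms by simp
    then have "(n choose m) * (n choose c) \<le> n ^ (c - 1) * n ^ c"
      using binomial_le_pow[of c n] c by (intro mult_le_mono) auto
    moreover have "(c - 1) + c = 2 * c - 1" using c by simp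
    ultimately show ?thesis using False by (simp add: c_def[symmetric] power_add[symmetric] min_def)
  qed
qed

text \<open>Let \<open>\<mu>\<close> be the minimum of \<open>m\<close> and \<open>c\<close>. The
  power is at most \<open>n\<close> to the \<open>- 3 * \<mu>\<close>, the binomials at most
  \<open>n\<close> to the \<open>2 * \<mu> - 1\<close>; the product has exponent
  \<open>- (\<mu> + 1)\<close>, at most \<open>-2\<close>. This is where the constant
  \<open>6\<close> enters.\<close>

lemma estimator_term_le:
  assumes m: "1 \<le> m" "m \<le> n" and K: "6 * ln (real n) \<le> real K"
  shows "real ((n choose m) * (n choose (Suc n - m))) * (1 - real (Suc n - m) / real n) ^ (K * m)
         \<le> 1 / real n ^ 2"
proof -
  define c where "c = Suc n - m"
  define \<mu> where "\<mu> = min m c"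
  have c: "1 \<le> c" "c \<le> n" "m + c = Suc n" and n: "n \<ge> 1" using m by (auto simp: c_def)
  have \<mu>: "1 \<le> \<mu>" using m c by (simp add: \<mu>_def)
  \<comment> \<open>As \<open>m + c = Suc n\<close>, the larger of the two exceeds
    \<open>n / 2\<close>.\<close>
  have "\<mu> * n \<le> \<mu> * (2 * max m c)" using c by (intro mult_le_mono) auto
  also have "\<mu> * (2 * max m c) = 2 * (m * c)" by (simp add: \<mu>_def min_def max_def)
  finally have "real (\<mu> * n) \<le> real (2 * (m * c))" by (simp only: of_nat_le_iff)
  then have mc: "real \<mu> \<le> 2 * (real m * real c) / real n" using n by (simp add: field_simps)
  have "(1 - real c / real n) ^ (K * m) \<le> exp (- (real c / real n)) ^ (K * m)"
    using exp_ge_add_one_self[of "- (real c / real n)"] c by (intro power_mono) (auto simp: divide_simps)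
  also have "\<dots> = exp (- (real K * (real m * real c / real n)))"
    by (simp add: exp_of_nat_mult[symmetric] mult_ac)
  also have "\<dots> \<le> exp (- (6 * ln (real n) * (real m * real c / real n)))"
    using mult_right_mono[OF K, of "real m * real c / real n"] by simp
  also have "\<dots> \<le> exp (- (real (3 * \<mu>) * ln (real n)))"
    using mult_left_mono[OF mc, of "3 * ln (real n)"] n by (simp add: mult_ac)
  also have "\<dots> = 1 / real n ^ (3 * \<mu>)"
    using n by (simp add: exp_minus exp_of_nat_mult divide_inverse del: of_nat_mult)
  finally have pow: "(1 - real c / real n) ^ (K * m) \<le> 1 / real n ^ (3 * \<mu>)" .
  have "real ((n choose m) * (n choose c)) \<le> real (n ^ (2 * \<mu> - 1))"
    using binomial_product_le[OF m] by (simp only: c_def \<mu>_def of_nat_le_iff)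
  then have "real ((n choose m) * (n choose c)) * (1 - real c / real n) ^ (K * m)
      \<le> real n ^ (2 * \<mu> - 1) * (1 / real n ^ (3 * \<mu>))"
    using pow c by (intro mult_mono) (auto simp: divide_simps)
  also have "\<dots> = 1 / real n ^ (\<mu> + 1)"
  proof -
    have "3 * \<mu> = (2 * \<mu> - 1) + (\<mu> + 1)" using \<mu> by simp
    then have "real n ^ (3 * \<mu>) = real n ^ (2 * \<mu> - 1) * real n ^ (\<mu> + 1)"
      by (metis power_add)
    then show ?thesis using n by (simp add: field_simps)
  qed
  also have "\<dots> \<le> 1 / real n ^ 2"
    using \<mu> n by (intro divide_left_mono power_increasing) auto
  finally show ?thesis by (simp only: c_def)
qed

lemma sum_nonempty_subsets_by_card:
  fixes g :: "nat \<Rightarrow> real"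
  shows "(\<Sum>J\<in>Pow {..<n} - {{}}. g (card J)) = (\<Sum>m=1..n. real (n choose m) * g m)"
proof -
  let ?S = "Pow {..<n::nat} - {{}}"
  have "card ` ?S \<subseteq> {1..n}"
  proof
    fix m assume "m \<in> card ` ?S"
    then obtain J where J: "J \<subseteq> {..<n}" "J \<noteq> {}" "m = card J" by auto
    then show "m \<in> {1..n}"
      using card_mono[OF _ J(1)] finite_subset[OF J(1)] by (simp add: Suc_le_eq card_gt_0_iff)
  qed
  then have "(\<Sum>J\<in>?S. g (card J)) = (\<Sum>m=1..n. \<Sum>J | J \<in> ?S \<and> card J = m. g (card J))"
    by (intro sum.group[symmetric]) auto
  also have "\<dots> = (\<Sum>m=1..n. real (n choose m) * g m)"
  proof (rule sum.cong[OF refl])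
    fix m assume "m \<in> {1..n}"
    then have "{J \<in> ?S. card J = m} = {J. J \<subseteq> {..<n} \<and> card J = m}" by auto
    then have "card {J \<in> ?S. card J = m} = n choose m"
      using n_subsets[of "{..<n}" m] by simp
    then show "(\<Sum>J | J \<in> ?S \<and> card J = m. g (card J)) = real (n choose m) * g m" by simp
  qed
  finally show ?thesis .
qed

text \<open>Grouped by cardinality, the sum has \<open>n\<close> terms of size at most
  \<open>1 / n^2\<close>, so the total is at most \<open>t / n\<close>.\<close>

lemma estimator_less_one:
  assumes n: "1 \<le> n" and t: "t < n" and K: "6 * ln (real n) \<le> real K"
  shows "real t * (\<Sum>J\<in>Pow {..<n} - {{}}.
      (1 - real (Suc n - card J) / real n) ^ (K * card J) * real (n choose (Suc n - card J))) < 1"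
proof -
  have "(\<Sum>J\<in>Pow {..<n} - {{}}.
      (1 - real (Suc n - card J) / real n) ^ (K * card J) * real (n choose (Suc n - card J)))
    = (\<Sum>m=1..n. real (n choose m) *
      ((1 - real (Suc n - m) / real n) ^ (K * m) * real (n choose (Suc n - m))))"
    by (rule sum_nonempty_subsets_by_card)
  also have "\<dots> \<le> (\<Sum>m=1..n. 1 / real n ^ 2)"
  proof (rule sum_mono)
    fix m assume "m \<in> {1..n}"
    then show "real (n choose m) * ((1 - real (Suc n - m) / real n) ^ (K * m) * real (n choose (Suc n - m)))
        \<le> 1 / real n ^ 2"
      using estimator_term_le[of m n K] K by (simp add: mult_ac)
  qed
  also have "\<dots> = 1 / real n" by (simp add: power2_eq_square)
  finally have "real t * (\<Sum>J\<in>Pow {..<n} - {{}}.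
      (1 - real (Suc n - card J) / real n) ^ (K * card J) * real (n choose (Suc n - card J)))
    \<le> real t * (1 / real n)" by (intro mult_left_mono) auto
  also have "\<dots> < 1" using n t by simp
  finally show ?thesis .
qed

section \<open>Construction of the disjoint transversals\<close>

text \<open>One choice of permutations makes the rank condition hold for all blocks simultaneously;
  Rado's theorem is then applied to each block separately.\<close>

lemma (in finite_matroid) disjoint_transversals:
  assumes B: "\<And>i. i < n \<Longrightarrow> indep (B i)" "\<And>i. i < n \<Longrightarrow> card (B i) = n"
    and disj: "\<And>i j. i < n \<Longrightarrow> j < n \<Longrightarrow> i \<noteq> j \<Longrightarrow> B i \<inter> B j = {}"
    and K: "6 * ln (real n) \<le> real K" and t: "t * K \<le> n" "t < n"
  shows "\<exists>f. (\<forall>j<t. (\<forall>i<n. f j i \<in> B i) \<and> inj_on (f j) {..<n} \<and> indep (f j ` {..<n})) \<and>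
    (\<forall>j<t. \<forall>l<t. j \<noteq> l \<longrightarrow> f j ` {..<n} \<inter> f l ` {..<n} = {})"
proof -
  have "\<exists>e. bij_betw e {..<n} (B i)" if "i < n" for i
    using ex_bij_betw_nat_finite[OF finite_indep[OF B(1)[OF that]]] B(2)[OF that]
    by (simp add: atLeast0LessThan)
  then obtain e where e: "\<And>i. i < n \<Longrightarrow> bij_betw (e i) {..<n} (B i)" by metis
  \<comment> \<open>Blocks of positions are the same for every basis; only the permutations decide
    which elements occupy them.\<close>
  define T where "T j = {j * K..<Suc j * K}" for j
  have T: "T j \<subseteq> {..<n}" if "j < t" for j
  proof -
    have "Suc j * K \<le> t * K" using that by (intro mult_le_mono) auto
    then show ?thesis using t(1) by (auto simp: T_def)
  qed
  have T_disj: "T j \<inter> T l = {}" if "j \<noteq> l" for j l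
  proof -
    have "T j \<inter> T l = {}" if "j < l" for j l
    proof -
      have "Suc j * K \<le> l * K" using that by (intro mult_le_mono) auto
      then show ?thesis by (auto simp: T_def)
    qed
    then show ?thesis using that by (metis inf_commute linorder_neqE_nat)
  qed
  \<comment> \<open>Each pair of a block and an index set is a possible failure. The empty index set
    is excluded because it would give \<open>c = n + 1\<close>, beyond the admissible range.\<close>
  define A where "A = {..<t} \<times> (Pow {..<n} - {{}})"
  \<comment> \<open>With this \<open>c\<close>, the coefficient \<open>(n - r) choose c\<close> is
    nonzero exactly when the rank \<open>r \<le> n\<close> is below the size of the index
    set.\<close>
  let ?c = "\<lambda>a :: nat \<times> nat set. Suc n - card (snd a)"
  let ?U = "\<lambda>s a. \<Union>i\<in>snd a. (e i \<circ> s i) ` T (fst a)"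
  have cJ: "1 \<le> card J \<and> card J \<le> n" if "J \<in> Pow {..<n} - {{}}" for J
    using card_mono[of "{..<n}" J] finite_subset[of J "{..<n}"] that
    by (auto simp: Suc_le_eq card_gt_0_iff)
  have "\<exists>s. (\<forall>i<n. s i permutes {..<n}) \<and>
    (\<Sum>a\<in>A. (1 - real (?c a) / real n) ^ (card (T (fst a)) * card (snd a \<inter> {n..<n})) *
       real ((n - rk (\<Union>i\<in>snd a \<inter> {..<n}. (e i \<circ> s i) ` T (fst a))) choose ?c a))
    \<le> (\<Sum>a\<in>A. (1 - real (?c a) / real n) ^ (card (T (fst a)) * card (snd a \<inter> {..<n})) *
       real (n choose ?c a))"
  proof (rule exists_permutations[OF B(1) e])
    fix a assume "a \<in> A"
    then have "fst a < t" "snd a \<in> Pow {..<n} - {{}}" by (auto simp: A_def)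
    then show "T (fst a) \<subseteq> {..<n}" "0 < ?c a \<and> ?c a \<le> n"
      using T cJ[of "snd a"] by auto
  qed (auto simp: A_def)
  then obtain s where s: "\<And>i. i < n \<Longrightarrow> s i permutes {..<n}"
    and s_le: "(\<Sum>a\<in>A. (1 - real (?c a) / real n) ^ (card (T (fst a)) * card (snd a \<inter> {n..<n})) *
       real ((n - rk (\<Union>i\<in>snd a \<inter> {..<n}. (e i \<circ> s i) ` T (fst a))) choose ?c a))
    \<le> (\<Sum>a\<in>A. (1 - real (?c a) / real n) ^ (card (T (fst a)) * card (snd a \<inter> {..<n})) *
       real (n choose ?c a))"
    by blast
  have inter: "snd a \<inter> {..<n} = snd a" if "a \<in> A" for a using that by (auto simp: A_def)
  \<comment> \<open>All bases are processed, so the exponent is \<open>0\<close> and only the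
    coefficients remain.\<close>
  have "(\<Sum>a\<in>A. real ((n - rk (?U s a)) choose ?c a))
      = (\<Sum>a\<in>A. (1 - real (?c a) / real n) ^ (card (T (fst a)) * card (snd a \<inter> {n..<n})) *
       real ((n - rk (\<Union>i\<in>snd a \<inter> {..<n}. (e i \<circ> s i) ` T (fst a))) choose ?c a))"
    by (intro sum.cong refl) (simp add: inter)
  also note s_le
  also have "(\<Sum>a\<in>A. (1 - real (?c a) / real n) ^ (card (T (fst a)) * card (snd a \<inter> {..<n})) *
       real (n choose ?c a))
     = (\<Sum>a\<in>A. (1 - real (?c a) / real n) ^ (K * card (snd a)) * real (n choose ?c a))"
    by (intro sum.cong refl) (simp add: inter T_def)
  also have "\<dots> = real t * (\<Sum>J\<in>Pow {..<n} - {{}}.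
      (1 - real (Suc n - card J) / real n) ^ (K * card J) * real (n choose (Suc n - card J)))"
    by (simp add: A_def sum.cartesian_product')
  also have "\<dots> < 1"
    by (rule estimator_less_one) (use t K in auto)
  finally have lt1: "(\<Sum>a\<in>A. real ((n - rk (?U s a)) choose ?c a)) < 1" .
  have rank: "card J \<le> rk (\<Union>i\<in>J. (e i \<circ> s i) ` T j)" if j: "j < t" and J: "J \<subseteq> {..<n}" for j J
  proof (cases "J = {}")
    case False
    then have a: "(j, J) \<in> A" using j J by (simp add: A_def)
    have "finite A" by (simp add: A_def)
    \<comment> \<open>A sum of natural numbers below \<open>1\<close> has only zero terms, so no
      rank condition fails.\<close>
    then have "real ((n - rk (?U s (j, J))) choose ?c (j, J)) < 1"
      by (intro le_less_trans[OF member_le_sum[OF a, of "\<lambda>a. real ((n - rk (?U s a)) choose ?c a)"] lt1]) auto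
    then have "n - rk (\<Union>i\<in>J. (e i \<circ> s i) ` T j) < Suc n - card J"
      by (simp add: binomial_eq_0_iff)
    then show ?thesis by linarith
  qed simp
  have "\<exists>f. (\<forall>i\<in>{..<n}. f i \<in> (e i \<circ> s i) ` T j) \<and> inj_on f {..<n} \<and> indep (f ` {..<n})"
    if j: "j < t" for j
    by (rule rado) (use rank[OF j] in \<open>auto simp: T_def\<close>)
  then obtain f where f: "\<And>j. j < t \<Longrightarrow> (\<forall>i\<in>{..<n}. f j i \<in> (e i \<circ> s i) ` T j) \<and>
      inj_on (f j) {..<n} \<and> indep (f j ` {..<n})"
    by metis
  have bij: "bij_betw (e i \<circ> s i) {..<n} (B i)" if "i < n" for i
    using bij_betw_trans[OF permutes_imp_bij[OF s[OF that]] e[OF that]] .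
  have fB: "f j i \<in> B i" if "j < t" "i < n" for i j
    using f[OF that(1)] that(2) T[OF that(1)] bij_betw_imp_surj_on[OF bij[OF that(2)]] by blast
  \<comment> \<open>A common element has the same index \<open>i\<close> in both transversals,
    because the bases are disjoint; inside \<open>B i\<close> it would occupy two disjoint
    blocks.\<close>
  have "f j ` {..<n} \<inter> f l ` {..<n} = {}" if jl: "j < t" "l < t" "j \<noteq> l" for j l
  proof (rule ccontr)
    assume "\<not> ?thesis"
    then obtain i i' where i: "i < n" "i' < n" "f j i = f l i'" by auto
    then have "i = i'" using disj[of i i'] fB[of j i] fB[of l i'] jl by auto
    then have "f j i = f l i" using i(3) by simp
    moreover have "f j i \<in> (e i \<circ> s i) ` T j" "f l i \<in> (e i \<circ> s i) ` T l"
      using f[OF jl(1)] f[OF jl(2)] i(1) by blast+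
    ultimately have "f j i \<in> (e i \<circ> s i) ` T j \<inter> (e i \<circ> s i) ` T l" by simp
    also have "\<dots> = (e i \<circ> s i) ` (T j \<inter> T l)"
      by (rule inj_on_image_Int[symmetric, OF bij_betw_imp_inj_on[OF bij[OF i(1)]] T[OF jl(1)] T[OF jl(2)]])
    finally show False using T_disj[OF jl(3)] by simp
  qed
  then show ?thesis using f fB by blast
qed

section \<open>Bases as independent sets of full rank, and the conclusion\<close>

lemma (in finite_matroid) matroid_rank_eq_rk: "matroid_rank E indep = rk E"
proof -
  have "{I. indep I} = {I. indep I \<and> I \<subseteq> E}" using indep_subset_carrier by blast
  then show ?thesis by (simp add: matroid_rank_def rk_def)
qed

text \<open>An inclusion-maximal independent set extends to one of size \<open>rk E\<close>, hence
  already has that size.\<close>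

lemma (in finite_matroid) basis_iff_card: "basis E indep X \<longleftrightarrow> indep X \<and> card X = rk E"
proof
  assume X: "basis E indep X"
  then have ind: "indep X" by (simp add: basis_def)
  obtain J where J: "X \<subseteq> J" "J \<subseteq> E" "indep J" "card J = rk E"
    using extend_to_rk[OF ind indep_subset_carrier[OF ind]] by blast
  have "J \<subseteq> X"
  proof
    fix x assume x: "x \<in> J"
    have "indep (insert x X)" using indep_subset[OF J(3)] J(1) x by blast
    then show "x \<in> X" using X x J(2) by (auto simp: basis_def)
  qed
  then show "indep X \<and> card X = rk E" using J ind by auto
next
  assume X: "indep X \<and> card X = rk E"
  have False if "x \<in> E - X" "indep (insert x X)" for x
    using card_le_rk[OF that(2) indep_subset_carrier[OF that(2)]] X that(1) finite_indep[of X] by simp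
  then show "basis E indep X" using X by (auto simp: basis_def)
qed

theorem theorem1p2:
  fixes E :: "'a set" and indep :: "'a set \<Rightarrow> bool" and n :: nat and B :: "nat \<Rightarrow> 'a set"
  assumes "matroid E indep"
    and "matroid_rank E indep = n"
    and "n \<ge> 2"
    and "\<And>i. i < n \<Longrightarrow> basis E indep (B i)"
    and "\<And>i j. i < n \<Longrightarrow> j < n \<Longrightarrow> i \<noteq> j \<Longrightarrow> B i \<inter> B j = {}"
  shows "\<exists>k T. k \<ge> nat \<lfloor>real n / (6 * real_of_int \<lceil>ln (real n)\<rceil>)\<rfloor> \<and>
           (\<forall>j < k. transversal_basis E indep n B (T j)) \<and>
           (\<forall>j < k. \<forall>l < k. j \<noteq> l \<longrightarrow> T j \<inter> T l = {})"
proof -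
  interpret finite_matroid E indep using assms(1) by unfold_locales
  define K where "K = nat (6 * \<lceil>ln (real n)\<rceil>)"
  define t where "t = n div K"
  have "0 < ln (real n)" using assms(3) by simp
  \<comment> \<open>The ceiling is positive because \<open>n \<ge> 2\<close>; this makes
    \<open>K\<close> at least \<open>6\<close> and later gives \<open>t < n\<close>.\<close>
  then have ceil: "1 \<le> \<lceil>ln (real n)\<rceil>" by simp
  then have K_real: "real K = 6 * real_of_int \<lceil>ln (real n)\<rceil>" by (simp add: K_def)
  have K_ge: "6 * ln (real n) \<le> real K" unfolding K_real by simp
  have "6 \<le> real K" unfolding K_real using ceil by linarith
  then have "6 \<le> K" by simp
  have t_eq: "nat \<lfloor>real n / (6 * real_of_int \<lceil>ln (real n)\<rceil>)\<rfloor> = t"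
    unfolding K_real[symmetric] t_def by (simp add: floor_divide_of_nat_eq)
  have rkE: "rk E = n" using assms(2) matroid_rank_eq_rk by simp
  have B: "indep (B i)" "card (B i) = n" if "i < n" for i
    using assms(4)[OF that] by (simp_all add: basis_iff_card rkE)
  have "t * K \<le> n" by (simp add: t_def)
  moreover have "t < n" using \<open>6 \<le> K\<close> assms(3) by (simp add: t_def)
  ultimately have "\<exists>f. (\<forall>j<t. (\<forall>i<n. f j i \<in> B i) \<and> inj_on (f j) {..<n} \<and> indep (f j ` {..<n})) \<and>
    (\<forall>j<t. \<forall>l<t. j \<noteq> l \<longrightarrow> f j ` {..<n} \<inter> f l ` {..<n} = {})"
    by (intro disjoint_transversals[OF B assms(5) K_ge])
  then obtain f where f: "\<And>i j. j < t \<Longrightarrow> i < n \<Longrightarrow> f j i \<in> B i"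
      "\<And>j. j < t \<Longrightarrow> inj_on (f j) {..<n} \<and> indep (f j ` {..<n})"
    and f_disj: "\<forall>j<t. \<forall>l<t. j \<noteq> l \<longrightarrow> f j ` {..<n} \<inter> f l ` {..<n} = {}" by blast
  have "transversal_basis E indep n B (f j ` {..<n})" if j: "j < t" for j
    unfolding transversal_basis_def basis_iff_card
  proof (intro conjI allI impI)
    show "indep (f j ` {..<n})" using f(2)[OF j] by simp
    show "card (f j ` {..<n}) = rk E" using f(2)[OF j] by (simp add: card_image rkE)
    fix i assume i: "i < n"
    \<comment> \<open>Any other \<open>f j i'\<close> lies in \<open>B i'\<close>, which is disjoint
      from \<open>B i\<close>.\<close>
    have "f j ` {..<n} \<inter> B i = {f j i}"
    proof
      show "f j ` {..<n} \<inter> B i \<subseteq> {f j i}"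
      proof
        fix x assume "x \<in> f j ` {..<n} \<inter> B i"
        then obtain i' where "i' < n" "x = f j i'" "x \<in> B i" by blast
        then show "x \<in> {f j i}" using f(1)[OF j, of i'] assms(5)[OF i, of i'] by blast
      qed
    qed (use i f(1)[OF j i] in blast)
    then show "card (f j ` {..<n} \<inter> B i) = 1" by simp
  qed
  then show ?thesis using f_disj t_eq by (intro exI[of _ t] exI[of _ "\<lambda>j. f j ` {..<n}"]) auto
qed

end
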